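(* Validity over all EGL-models does not coincide with validity over crisp models. Namely, for an atomic proposition $p\in\mathcal P$ and an agent $a\in\mathcal A$, the formula $\neg\neg B_a\neg p\to B_a\neg p$ is true in every crisp EGL-model but is not valid in the class of all EGL-models.
   Context: Fix a set $\mathcal P$ of atomic propositions and a set $\mathcal A$ of agents. Formulas: $\varphi ::= p \mid \bot \mid \varphi\wedge\varphi \mid \varphi\to\varphi \mid B_a\varphi$ with $p\in\mathcal P$, $a\in\mathcal A$; $\neg\varphi=\varphi\to\bot$. An EGL-model is $M=(S,(r_a)_{a\in\mathcal A},\pi)$ where $S$ is a non-empty countable set, each $r_a:S\times S\to[0,1]$, and $\pi:S\times\mathcal P\to[0,1]$. Values: $V_s(p)=\pi(s,p)$; $V_s(\bot)=0$; $V_s(\varphi\wedge\psi)=\min\{V_s(\varphi),V_s(\psi)\}$; $V_s(\varphi\to\psi)=1$ if $V_s(\varphi)\le V_s(\psi)$ and $=V_s(\psi)$ otherwise; $V_s(B_a\varphi)=\inf_{s'\in S}\max\{1-r_a(s,s'),V_{s'}(\varphi)\}$. $\varphi$ is true in $M$ if $V_s(\varphi)=1$ for all $s\in S$; $\varphi$ is valid if true in all EGL-models. An EGL-model is crisp if its accessibility relations take values in $\{0,1\}$. *)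

theory Defs
  imports Complex_Main "HOL-Library.Countable_Set"
begin

text \<open>Atomic propositions are the elements of \<open>'p\<close>, agents those of \<open>'a\<close>.\<close>

datatype ('p, 'a) form =
    Atom 'p
  | Bot
  | And "('p, 'a) form" "('p, 'a) form"
  | Imp "('p, 'a) form" "('p, 'a) form"
  | Bel 'a "('p, 'a) form"

definition Neg :: "('p, 'a) form \<Rightarrow> ('p, 'a) form" where
  "Neg \<phi> = Imp \<phi> Bot"

record ('s, 'p, 'a) egl =
  states :: "'s set"
  acc :: "'a \<Rightarrow> 's \<Rightarrow> 's \<Rightarrow> real"
  val :: "'s \<Rightarrow> 'p \<Rightarrow> real"

text \<open>Functions on \<open>S\<close> are total functions on the type \<open>'s\<close>, whose values outside
  \<open>S\<close> are unconstrained and never used.\<close>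

definition egl_model :: "('s, 'p, 'a) egl \<Rightarrow> bool" where
  "egl_model M \<longleftrightarrow>
     states M \<noteq> {} \<and> countable (states M) \<and>
     (\<forall>a. \<forall>s\<in>states M. \<forall>s'\<in>states M. acc M a s s' \<in> {0..1}) \<and>
     (\<forall>s\<in>states M. \<forall>p. val M s p \<in> {0..1})"

definition crisp :: "('s, 'p, 'a) egl \<Rightarrow> bool" where
  "crisp M \<longleftrightarrow> (\<forall>a. \<forall>s\<in>states M. \<forall>s'\<in>states M. acc M a s s' \<in> {0, 1})"

text \<open>In an EGL-model the infimum below is that of a non-empty set of reals bounded
  below by \<open>0\<close>, so it is the genuine infimum.\<close>

primrec V :: "('s, 'p, 'a) egl \<Rightarrow> 's \<Rightarrow> ('p, 'a) form \<Rightarrow> real" where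
  "V M s (Atom p) = val M s p"
| "V M s Bot = 0"
| "V M s (And \<phi> \<psi>) = min (V M s \<phi>) (V M s \<psi>)"
| "V M s (Imp \<phi> \<psi>) = (if V M s \<phi> \<le> V M s \<psi> then 1 else V M s \<psi>)"
| "V M s (Bel a \<phi>) = (INF s'\<in>states M. max (1 - acc M a s s') (V M s' \<phi>))"

definition true_in :: "('s, 'p, 'a) egl \<Rightarrow> ('p, 'a) form \<Rightarrow> bool" where
  "true_in M \<phi> \<longleftrightarrow> (\<forall>s\<in>states M. V M s \<phi> = 1)"

text \<open>A definition cannot quantify over all state types. Since the state sets are
  countable, it suffices to let them range over the non-empty subsets of \<open>nat\<close>;
  \<open>egl_valid_imp_true\<close> and \<open>crisp_valid_imp_true\<close> below show that nothing is lost.\<close>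

definition egl_valid :: "('p, 'a) form \<Rightarrow> bool" where
  "egl_valid \<phi> \<longleftrightarrow> (\<forall>M :: (nat, 'p, 'a) egl. egl_model M \<longrightarrow> true_in M \<phi>)"

definition crisp_valid :: "('p, 'a) form \<Rightarrow> bool" where
  "crisp_valid \<phi> \<longleftrightarrow> (\<forall>M :: (nat, 'p, 'a) egl. egl_model M \<and> crisp M \<longrightarrow> true_in M \<phi>)"

definition nat_copy :: "('s, 'p, 'a) egl \<Rightarrow> (nat, 'p, 'a) egl" where
  "nat_copy M = (let S = states M; g = from_nat_into S in
     \<lparr>states = to_nat_on S ` S, acc = (\<lambda>a x y. acc M a (g x) (g y)), val = (\<lambda>x. val M (g x))\<rparr>)"

lemma nat_copy_model: "egl_model M \<Longrightarrow> egl_model (nat_copy M)"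
  by (auto simp: egl_model_def nat_copy_def Let_def)

lemma nat_copy_crisp: "egl_model M \<Longrightarrow> crisp M \<Longrightarrow> crisp (nat_copy M)"
  by (auto simp: egl_model_def crisp_def nat_copy_def Let_def)

lemma V_nat_copy:
  assumes "countable (states M)" "s \<in> states M"
  shows "V (nat_copy M) (to_nat_on (states M) s) \<phi> = V M s \<phi>"
  using assms(2)
proof (induction \<phi> arbitrary: s)
  case (Bel a \<phi>)
  have st: "states (nat_copy M) = to_nat_on (states M) ` states M"
    by (simp add: nat_copy_def Let_def)
  have "acc (nat_copy M) a (to_nat_on (states M) s) (to_nat_on (states M) t) = acc M a s t"
    if "t \<in> states M" for t
    using that Bel.prems assms(1) by (simp add: nat_copy_def Let_def)
  then show ?case
    by (simp add: st image_image Bel.IH cong: image_cong_simp)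
qed (use assms(1) in \<open>simp_all add: nat_copy_def Let_def\<close>)

lemma true_in_nat_copy:
  "egl_model M \<Longrightarrow> true_in (nat_copy M) \<phi> \<longleftrightarrow> true_in M \<phi>"
  using V_nat_copy[of M] by (auto simp: true_in_def egl_model_def nat_copy_def Let_def)

lemma egl_valid_imp_true:
  fixes M :: "('s, 'p, 'a) egl"
  shows "egl_valid \<phi> \<Longrightarrow> egl_model M \<Longrightarrow> true_in M \<phi>"
  using nat_copy_model true_in_nat_copy unfolding egl_valid_def by blast

lemma crisp_valid_imp_true:
  fixes M :: "('s, 'p, 'a) egl"
  shows "crisp_valid \<phi> \<Longrightarrow> egl_model M \<Longrightarrow> crisp M \<Longrightarrow> true_in M \<phi>"
  using nat_copy_model nat_copy_crisp true_in_nat_copy unfolding crisp_valid_def by blast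

end

(* In a crisp model the infimum defining B_a(not p) ranges over a set of values in {0,1}, so
   it is itself 0 or 1 and double negation does nothing to it. A single state with
   r_a = 1/2 and p = 1 gives B_a(not p) the value 1/2, whose double negation is 1. *)
theory Submission
  imports Defs
begin

text \<open>Makes every negated formula two-valued in any model, so only the accessibility relations
  can give \<open>Bel a (Neg \<phi>)\<close> an intermediate value.\<close>

lemma V_Neg: "V M s (Neg \<phi>) = (if V M s \<phi> \<le> 0 then 1 else 0)"
  by (simp add: Neg_def)

text \<open>The image is finite and non-empty, so its infimum is attained.\<close>

lemma cINF_zero_one:
  fixes f :: "'s \<Rightarrow> real"
  assumes "S \<noteq> {}" and f: "\<And>x. x \<in> S \<Longrightarrow> f x \<in> {0, 1}"
  shows "(INF x\<in>S. f x) \<in> {0, 1}"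
proof -
  have "f ` S \<subseteq> {0, 1}"
    using f by blast
  then have "finite (f ` S)"
    by (rule finite_subset) simp
  moreover have "f ` S \<noteq> {}"
    using assms(1) by simp
  ultimately have "Inf (f ` S) \<in> f ` S"
    by (metis cInf_eq_Min Min_in)
  with \<open>f ` S \<subseteq> {0, 1}\<close> show ?thesis
    by blast
qed

lemma crisp_V_Bel:
  assumes "crisp M" "s \<in> states M" "\<And>t. t \<in> states M \<Longrightarrow> V M t \<phi> \<in> {0, 1}"
  shows "V M s (Bel a \<phi>) \<in> {0, 1}"
  unfolding V.simps
proof (rule cINF_zero_one)
  show "states M \<noteq> {}"
    using assms(2) by blast
next
  fix t assume "t \<in> states M"
  then have "acc M a s t \<in> {0, 1}" "V M t \<phi> \<in> {0, 1}"
    using assms unfolding crisp_def by blast+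
  then show "max (1 - acc M a s t) (V M t \<phi>) \<in> {0, 1}"
    by auto
qed

lemma crisp_double_neg_Bel_Neg:
  assumes "crisp M"
  shows "true_in M (Imp (Neg (Neg (Bel a (Neg \<phi>)))) (Bel a (Neg \<phi>)))"
  unfolding true_in_def
proof
  fix s assume "s \<in> states M"
  then have "V M s (Bel a (Neg \<phi>)) \<in> {0, 1}"
    by (rule crisp_V_Bel[OF assms]) (simp add: V_Neg)
  then show "V M s (Imp (Neg (Neg (Bel a (Neg \<phi>)))) (Bel a (Neg \<phi>))) = 1"
    \<comment> \<open>The belief value stays folded, so that the case split into 0 and 1 applies to
      it; double negation fixes both values.\<close>
    by (auto simp: V_Neg V.simps(4) simp del: V.simps(5))
qed

lemma double_neg_Bel_Neg_not_valid:
  fixes p :: 'p and a :: 'a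
  shows "\<not> egl_valid (Imp (Neg (Neg (Bel a (Neg (Atom p))))) (Bel a (Neg (Atom p))))"
proof -
  define M :: "(nat, 'p, 'a) egl" where
    "M = \<lparr>states = {0}, acc = (\<lambda>_ _ _. 1/2), val = (\<lambda>_ _. 1)\<rparr>"
  have "egl_model M"
    by (simp add: M_def egl_model_def)
  \<comment> \<open>The premise has value 1, above the conclusion's 1/2, so the implication has
    value 1/2. Any constant accessibility strictly between 0 and 1 would do.\<close>
  moreover have "\<not> true_in M (Imp (Neg (Neg (Bel a (Neg (Atom p))))) (Bel a (Neg (Atom p))))"
    by (simp add: M_def true_in_def V_Neg)
  ultimately show ?thesis
    unfolding egl_valid_def by blast
qed

theorem mainTheorem7:
  fixes p :: 'p and a :: 'a
  shows "{\<phi> :: ('p, 'a) form. egl_valid \<phi>} \<noteq> {\<phi>. crisp_valid \<phi>} \<and>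
    (\<forall>M :: ('s, 'p, 'a) egl. egl_model M \<and> crisp M \<longrightarrow>
       true_in M (Imp (Neg (Neg (Bel a (Neg (Atom p))))) (Bel a (Neg (Atom p))))) \<and>
    \<not> egl_valid (Imp (Neg (Neg (Bel a (Neg (Atom p))))) (Bel a (Neg (Atom p))))"
proof -
  \<comment> \<open>This formula separates the two sets. The lemma on crisp models is polymorphic in
    the state type, so it serves both here, over \<open>nat\<close>, and for the conjunct over
    \<open>'s\<close>.\<close>
  have "crisp_valid (Imp (Neg (Neg (Bel a (Neg (Atom p))))) (Bel a (Neg (Atom p))))"
    by (simp add: crisp_valid_def crisp_double_neg_Bel_Neg)
  moreover have "\<not> egl_valid (Imp (Neg (Neg (Bel a (Neg (Atom p))))) (Bel a (Neg (Atom p))))"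
    by (rule double_neg_Bel_Neg_not_valid)
  ultimately show ?thesis
    by (auto intro: crisp_double_neg_Bel_Neg)
qed

end
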